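(* Let $z^\star\in\mathbb{T}^n$, let $\Delta\in\mathbb{C}^{n\times n}$ be a Hermitian matrix with zero diagonal, let $C=(z^\star)(z^\star)^H+\Delta$, and let $f(z)=z^HCz$. Suppose that (i) $\|\Delta\|_{\rm op}\le\frac{n^{3/4}}{312}$ and $\|\Delta z^\star\|_\infty\le\frac{n}{24}$, (ii) the step size $\alpha$ satisfies $\alpha\in\left[4,\frac{n}{\|\Delta\|_{\rm op}}\right)$, and (iii) the initial point is $z^0=v_C$ (the eigenvector estimator of $C$). Then the sequence of iterates $\{z^k\}_{k\ge0}$ generated by the generalized power method with objective matrix $C$, step size $\alpha$ and initial point $z^0$ satisfies $$ f(\hat z)-f(z^k)\le\left(f(\hat z)-f(z^0)\right)\lambda^k, $$ $$ d_2(z^k,\hat z)\le a\left(f(\hat z)-f(z^0)\right)^{1/2}\lambda^{k/2} $$ for $k=0,1,\ldots$, where $a>0$ and $\lambda\in(0,1)$ are quantities that depend only on $n$ and $\alpha$, and $\hat z$ is any global maximizer of $f$ over $\mathbb{T}^n$.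
   Context: $\mathbb{T}^n=\{w\in\mathbb{C}^n: |w_1|=\cdots=|w_n|=1\}$; $(\cdot)^H$ is the Hermitian transpose; $\|\cdot\|_{\rm op}$ is the operator norm; $n/0$ is read as $+\infty$. For $v\in\mathbb{C}^n$, $\frac{v}{|v|}\in\mathbb{C}^n$ is the vector with $j$-th entry $v_j/|v_j|$ if $v_j\ne 0$ and $0$ otherwise. Distance: for $q\in[1,\infty]$, $d_q(w,z)=\min_{\theta\in[0,2\pi)}\|w-e^{i\theta}z\|_q$ (the same formula is used should an iterate have a zero entry). Generalized power method: given a Hermitian matrix $C\in\mathbb{C}^{n\times n}$, a step size $\alpha>0$ and an initial point $z^0\in\mathbb{T}^n$, the iterates are defined for $k=0,1,\ldots$ by $w^k=\left(I+\frac{\alpha}{n}C\right)z^k$, $z^{k+1}=\frac{w^k}{|w^k|}$ (run without termination). Eigenvector estimator: let $u\in\mathbb{C}^n$ be a leading eigenvector of $C$ (an eigenvector for the largest eigenvalue) and let $a'\in\mathbb{C}^n$ be any vector with $(a')^Hu\ne 0$. Then $v_C\in\mathbb{T}^n$ is defined by $(v_C)_j=\frac{u_j}{|u_j|}$ if $u_j\ne0$ and $(v_C)_j=\frac{(a')^Hu}{|(a')^Hu|}$ otherwise, $j=1,\dots,n$. *)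

theory Defs
  imports "HOL-Analysis.Analysis"
begin

definition torus :: "(complex^'n) set" where
  "torus = {w. \<forall>j. cmod (w $ j) = 1}"

definition hermitian_transpose :: "complex^'n^'m \<Rightarrow> complex^'m^'n" where
  "hermitian_transpose A = (\<chi> i j. cnj (A $ j $ i))"

definition hermitian :: "complex^'n^'n \<Rightarrow> bool" where
  "hermitian A \<longleftrightarrow> hermitian_transpose A = A"

definition herm_inner :: "complex^'n \<Rightarrow> complex^'n \<Rightarrow> complex" where
  "herm_inner v w = (\<Sum>j\<in>UNIV. cnj (v $ j) * w $ j)"

definition outer_product :: "complex^'n \<Rightarrow> complex^'n \<Rightarrow> complex^'n^'n" where
  "outer_product v w = (\<chi> i j. v $ i * cnj (w $ j))"

text \<open>For Hermitian \<open>C\<close> the value \<open>z\<^sup>H C z\<close> is real (lemma \<open>quad_form_real\<close> below), so that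
  \<open>Re\<close> is only a change of type.\<close>

definition quad_form :: "complex^'n^'n \<Rightarrow> complex^'n \<Rightarrow> real" where
  "quad_form C z = Re (herm_inner z (C *v z))"

lemma quad_form_real:
  assumes "hermitian C"
  shows "herm_inner z (C *v z) = complex_of_real (quad_form C z)"
proof -
  have C: "cnj (C $ i $ j) = C $ j $ i" for i j
    using assms unfolding hermitian_def hermitian_transpose_def by (metis vec_lambda_beta)
  have "cnj (herm_inner z (C *v z)) = (\<Sum>i\<in>UNIV. \<Sum>j\<in>UNIV. z $ i * (C $ j $ i * cnj (z $ j)))"
    by (simp add: herm_inner_def matrix_vector_mult_def C sum_distrib_left)
  also have "\<dots> = (\<Sum>j\<in>UNIV. \<Sum>i\<in>UNIV. z $ i * (C $ j $ i * cnj (z $ j)))"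
    by (rule sum.swap)
  also have "\<dots> = herm_inner z (C *v z)"
    by (simp add: herm_inner_def matrix_vector_mult_def sum_distrib_left mult_ac)
  finally show ?thesis
    by (simp add: quad_form_def complex_eq_iff)
qed

definition global_maximizer_on :: "('a \<Rightarrow> real) \<Rightarrow> 'a set \<Rightarrow> 'a \<Rightarrow> bool" where
  "global_maximizer_on f S x \<longleftrightarrow> x \<in> S \<and> (\<forall>y\<in>S. f y \<le> f x)"

text \<open>The norm of \<^typ>\<open>complex^'n\<close> is the Euclidean one, so this is the usual operator norm.\<close>

abbreviation op_norm :: "complex^'n^'n \<Rightarrow> real" where
  "op_norm A \<equiv> onorm (\<lambda>x. A *v x)"

text \<open>The library's \<open>infnorm\<close> would take the maximum over real and imaginary parts separately
  instead of over the moduli of the entries.\<close>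

definition linf_norm :: "complex^'n \<Rightarrow> real" where
  "linf_norm v = Max (range (\<lambda>j. cmod (v $ j)))"

text \<open>The infimum is attained (lemma \<open>d2_attained\<close> below), so it is a minimum.\<close>

definition d2 :: "complex^'n \<Rightarrow> complex^'n \<Rightarrow> real" where
  "d2 w z = (INF \<theta>\<in>{0..<2 * pi}. norm (w - cis \<theta> *s z))"

lemma d2_attained:
  fixes w z :: "complex^'n"
  shows "\<exists>\<theta>\<in>{0..<2 * pi}. d2 w z = norm (w - cis \<theta> *s z) \<and>
    (\<forall>\<phi>\<in>{0..<2 * pi}. norm (w - cis \<theta> *s z) \<le> norm (w - cis \<phi> *s z))"
proof -
  let ?g = "\<lambda>\<theta>. norm (w - cis \<theta> *s z)"
  have "continuous_on {0..2 * pi} ?g"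
    unfolding norm_vec_def L2_set_def
    by (auto intro!: continuous_intros simp: cis_conv_exp)
  moreover have "{0..2 * pi} \<noteq> {}"
    by simp
  ultimately obtain t where t: "t \<in> {0..2 * pi}" "\<forall>y\<in>{0..2 * pi}. ?g t \<le> ?g y"
    using continuous_attains_inf[of "{0..2 * pi}" ?g] by auto
  define s where "s = (if t = 2 * pi then 0 else t)"
  have s: "s \<in> {0..<2 * pi}" and gs: "?g s = ?g t"
    using t(1) by (auto simp: s_def)
  have min: "\<forall>y\<in>{0..<2 * pi}. ?g s \<le> ?g y"
    using t(2) by (auto simp: gs)
  have "d2 w z = ?g s"
    unfolding d2_def using s min by (intro cInf_eq_minimum) auto
  with s min show ?thesis by blast
qed

text \<open>Entrywise \<open>v / |v|\<close>; on complex numbers \<^term>\<open>sgn x\<close> is \<open>x / |x|\<close>, with \<open>sgn 0 = 0\<close>.\<close>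

definition entrywise_phase :: "complex^'n \<Rightarrow> complex^'n" where
  "entrywise_phase v = (\<chi> j. sgn (v $ j))"

primrec gpm :: "complex^'n^'n \<Rightarrow> real \<Rightarrow> complex^'n \<Rightarrow> nat \<Rightarrow> complex^'n" where
  "gpm C \<alpha> z0 0 = z0"
| "gpm C \<alpha> z0 (Suc k) =
     entrywise_phase ((mat 1 + (\<alpha> / real CARD('n)) *\<^sub>R C) *v gpm C \<alpha> z0 k)"

definition eigenpair :: "complex^'n^'n \<Rightarrow> complex \<Rightarrow> complex^'n \<Rightarrow> bool" where
  "eigenpair A \<mu> u \<longleftrightarrow> u \<noteq> 0 \<and> A *v u = \<mu> *s u"

text \<open>Intended for Hermitian matrices, all of whose eigenvalues are real.\<close>

definition leading_eigenvector :: "complex^'n^'n \<Rightarrow> complex^'n \<Rightarrow> bool" where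
  "leading_eigenvector A u \<longleftrightarrow>
     (\<exists>\<mu>::real. eigenpair A (complex_of_real \<mu>) u \<and>
       (\<forall>(\<nu>::real) v. eigenpair A (complex_of_real \<nu>) v \<longrightarrow> \<nu> \<le> \<mu>))"

definition eigenvector_estimator :: "complex^'n \<Rightarrow> complex^'n \<Rightarrow> complex^'n" where
  "eigenvector_estimator a' u =
     (\<chi> j. if u $ j \<noteq> 0 then sgn (u $ j) else sgn (herm_inner a' u))"

end

(* Every point of the torus (or of the sphere of radius sqrt n) whose value is at least
   f z* - O(E^2), with E the operator norm of the noise, lies up to a global phase within O(E / sqrt n)
   of z*, because the signal part of f loses n d^2 / 2 at distance d while the noise part
   changes by at most 2 sqrt n E d. The top eigenvector satisfies this, hence so does its entrywise
   projection, and since the power method never decreases f all iterates stay in this region.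
   There the vector w = (n / \<alpha>) z + C z has entries of modulus at least 0.7 n, while C and n / \<alpha>
   contribute at most 0.26 n to the quadratic part of f in phase-aligned directions. Hence one step
   gains at least half of the gap to the maximum, so that \<lambda> = 1 / 2 works for all n and \<alpha>. *)

theory Submission
  imports Defs
begin

section \<open>Hermitian forms\<close>

lemma inner_eq_Re_herm_inner: "v \<bullet> w = Re (herm_inner v w)"
  by (simp add: herm_inner_def inner_vec_def inner_complex_def)

lemma quad_form_eq_inner: "quad_form A z = z \<bullet> (A *v z)"
  by (simp add: quad_form_def inner_eq_Re_herm_inner)

lemma herm_inner_self: "herm_inner v v = of_real ((norm v)\<^sup>2)"
proof (rule complex_eqI)
  show "Re (herm_inner v v) = Re (of_real ((norm v)\<^sup>2))"
    by (simp add: power2_norm_eq_inner inner_eq_Re_herm_inner)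
  show "Im (herm_inner v v) = Im (of_real ((norm v)\<^sup>2))"
    by (simp add: herm_inner_def)
qed

lemma herm_inner_add_right: "herm_inner v (x + y) = herm_inner v x + herm_inner v y"
  by (simp add: herm_inner_def sum.distrib algebra_simps)

lemma herm_inner_diff_right: "herm_inner v (x - y) = herm_inner v x - herm_inner v y"
  by (simp add: herm_inner_def sum_subtractf algebra_simps)

lemma herm_inner_scale_right: "herm_inner v (c *s x) = c * herm_inner v x"
  by (simp add: herm_inner_def sum_distrib_left mult_ac)

lemma herm_inner_scale_left: "herm_inner (c *s v) x = cnj c * herm_inner v x"
  by (simp add: herm_inner_def sum_distrib_left mult_ac)

lemma herm_inner_adjoint:
  "herm_inner x (A *v y) = herm_inner (hermitian_transpose A *v x) y"
proof -
  have "herm_inner x (A *v y) = (\<Sum>i\<in>UNIV. \<Sum>j\<in>UNIV. cnj (x $ i) * A $ i $ j * y $ j)"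
    by (simp add: herm_inner_def matrix_vector_mult_def sum_distrib_left mult_ac)
  also have "\<dots> = (\<Sum>j\<in>UNIV. \<Sum>i\<in>UNIV. cnj (x $ i) * A $ i $ j * y $ j)"
    by (rule sum.swap)
  also have "\<dots> = herm_inner (hermitian_transpose A *v x) y"
    by (simp add: herm_inner_def matrix_vector_mult_def hermitian_transpose_def
        sum_distrib_left sum_distrib_right mult_ac)
  finally show ?thesis .
qed

lemma hermitian_inner_adjoint:
  assumes "hermitian A"
  shows "x \<bullet> (A *v y) = (A *v x) \<bullet> y"
  using assms by (simp add: inner_eq_Re_herm_inner herm_inner_adjoint[of x A y] hermitian_def)

lemma bounded_linear_matrix_vector_mult: "bounded_linear (\<lambda>x. (A :: complex^'n^'m) *v x)"
proof -
  have "linear (\<lambda>x. A *v x)"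
    by (auto intro!: linearI simp: vec_eq_iff matrix_vector_mult_def scaleR_sum_right
        distrib_left sum.distrib)
  then show ?thesis by (rule linear_conv_bounded_linear[THEN iffD1])
qed

lemma norm_matrix_vector_mult_le: "norm ((A :: complex^'n^'n) *v x) \<le> op_norm A * norm x"
  by (rule onorm[OF bounded_linear_matrix_vector_mult])

lemma op_norm_nonneg: "0 \<le> op_norm A"
  by (rule onorm_pos_le[OF bounded_linear_matrix_vector_mult])

lemma abs_inner_matrix_le: "\<bar>x \<bullet> (A *v y)\<bar> \<le> op_norm A * norm x * norm y"
proof -
  have "\<bar>x \<bullet> (A *v y)\<bar> \<le> norm x * norm (A *v y)"
    by (rule Cauchy_Schwarz_ineq2)
  also have "\<dots> \<le> norm x * (op_norm A * norm y)"
    by (intro mult_left_mono norm_matrix_vector_mult_le) auto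
  finally show ?thesis by (simp add: mult_ac)
qed

lemma matrix_vector_mult_scaleR: "(A :: complex^'n^'m) *v (r *\<^sub>R x) = r *\<^sub>R (A *v x)"
  by (rule linear_scale[OF bounded_linear.linear[OF bounded_linear_matrix_vector_mult]])

lemma scaleR_eq_scale: "r *\<^sub>R (x :: complex^'n) = complex_of_real r *s x"
  by (simp add: vec_eq_iff scaleR_conv_of_real[where 'a = complex])

lemma norm_scale_unimodular:
  assumes "cmod c = 1"
  shows "norm (c *s (x :: complex^'n)) = norm x"
  using assms by (simp add: norm_vec_def norm_mult)

lemma cnj_mult_unimodular:
  assumes "cmod c = 1"
  shows "cnj c * c = 1" "c * cnj c = 1"
  using assms complex_norm_square[of c] by (simp_all add: mult.commute)

lemma quad_form_scale_unimodular:
  assumes "cmod c = 1"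
  shows "quad_form A (c *s x) = quad_form A x"
proof -
  have "herm_inner (c *s x) (A *v (c *s x)) = (cnj c * c) * herm_inner x (A *v x)"
    by (simp add: vector_scalar_commute herm_inner_scale_left herm_inner_scale_right mult_ac)
  then show ?thesis by (simp add: quad_form_def cnj_mult_unimodular assms)
qed

section \<open>Leading eigenvectors as maximizers of the quadratic form\<close>

text \<open>By compactness the form attains a maximum \<open>\<mu>\<close> on the unit sphere at
  some \<open>v\<close>. The defect \<open>\<mu> * (norm x)\<^sup>2 - quad_form C x\<close> is
  nonnegative and vanishes at \<open>v\<close>; along the residual \<open>b\<close> of the
  eigenvalue equation its linear term is \<open>2 * t * (b \<bullet> b)\<close>, which forces
  \<open>b = 0\<close>.\<close>

lemma hermitian_top_eigenvector:
  fixes C :: "complex^'n^'n"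
  assumes "hermitian C"
  shows "\<exists>\<mu> v. eigenpair C (complex_of_real \<mu>) v \<and> (\<forall>x. quad_form C x \<le> \<mu> * (norm x)\<^sup>2)"
proof -
  let ?q = "\<lambda>x. x \<bullet> (C *v x)"
  have "continuous_on (sphere 0 1) ?q"
    by (intro continuous_intros bounded_linear.continuous_on[OF bounded_linear_matrix_vector_mult])
  moreover have "compact (sphere 0 1 :: (complex^'n) set)" by simp
  moreover have "axis undefined 1 \<in> (sphere 0 1 :: (complex^'n) set)"
    by simp
  ultimately obtain v where v: "v \<in> sphere 0 1" and vmax: "\<And>x. x \<in> sphere 0 1 \<Longrightarrow> ?q x \<le> ?q v"
    using continuous_attains_sup[of "sphere 0 1 :: (complex^'n) set" ?q] by blast
  define \<mu> where "\<mu> = ?q v"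
  have nv: "norm v = 1" using v by simp
  have le: "?q x \<le> \<mu> * (norm x)\<^sup>2" for x
  proof (cases "x = 0")
    case False
    then have "?q (inverse (norm x) *\<^sub>R x) \<le> \<mu>"
      unfolding \<mu>_def by (intro vmax) simp
    then have "?q x / (norm x)\<^sup>2 \<le> \<mu>"
      by (simp add: matrix_vector_mult_scaleR power2_eq_square field_simps)
    with False show ?thesis by (simp add: field_simps)
  qed simp
  define b where "b = \<mu> *\<^sub>R v - C *v v"
  define K where "K = \<mu> * (norm b)\<^sup>2 - ?q b"
  have "0 \<le> 2 * t * (b \<bullet> b) + t\<^sup>2 * K" for t
  proof -
    have "0 \<le> \<mu> * (norm (v + t *\<^sub>R b))\<^sup>2 - ?q (v + t *\<^sub>R b)"
      using le[of "v + t *\<^sub>R b"] by simp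
    also have "\<dots> = \<mu> * (norm v)\<^sup>2 - ?q v + 2 * t * (b \<bullet> b) + t\<^sup>2 * K"
      using hermitian_inner_adjoint[OF assms, of v b]
      unfolding K_def power2_norm_eq_inner
      by (simp add: b_def[symmetric] matrix_vector_right_distrib matrix_vector_mult_scaleR
          inner_add_left inner_add_right inner_commute algebra_simps power2_eq_square)
         (simp add: b_def algebra_simps inner_commute)
    finally show ?thesis using nv by (simp add: \<mu>_def)
  qed
  then have bound: "0 \<le> 2 * t * (b \<bullet> b) + t\<^sup>2 * K" for t .
  have "b \<bullet> b = 0"
  proof (rule ccontr)
    assume "b \<bullet> b \<noteq> 0"
    then have pos: "b \<bullet> b > 0" by simp
    \<comment> \<open>Negative, and so small that the quadratic term cannot offset the linear one:
      \<open>t * K\<close> is at least \<open>- (b \<bullet> b)\<close>.\<close>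
    define t where "t = - (b \<bullet> b) / (1 + \<bar>K\<bar>)"
    have t: "t * (1 + \<bar>K\<bar>) = - (b \<bullet> b)" "t < 0"
      using pos by (auto simp: t_def divide_simps)
    have "2 * (b \<bullet> b) + t * K \<le> 0"
    proof -
      have "0 \<le> t * (2 * (b \<bullet> b) + t * K)"
        using bound[of t] by (simp add: power2_eq_square algebra_simps)
      with t(2) show ?thesis by (simp add: zero_le_mult_iff)
    qed
    moreover have "t * K \<ge> t * (1 + \<bar>K\<bar>)"
      using t(2) by (intro mult_left_mono_neg) auto
    ultimately show False using t(1) pos by simp
  qed
  then have "C *v v = \<mu> *\<^sub>R v" by (simp add: b_def)
  moreover have "v \<noteq> 0" using nv by auto
  ultimately show ?thesis
    using le by (auto simp: eigenpair_def scaleR_eq_scale quad_form_eq_inner)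
qed

text \<open>\<open>leading_eigenvector\<close> compares eigenvalues only. Since the maximum of the
  form on the unit sphere is itself an eigenvalue, the eigenvalue of \<open>u\<close> is at least
  that maximum.\<close>

lemma leading_eigenvector_quad_form_ge:
  assumes "hermitian C" "leading_eigenvector C u"
  shows "quad_form C x * (norm u)\<^sup>2 \<le> quad_form C u * (norm x)\<^sup>2" "u \<noteq> 0"
proof -
  obtain \<mu> where \<mu>: "eigenpair C (complex_of_real \<mu>) u"
    and lead: "\<And>\<nu> v. eigenpair C (complex_of_real \<nu>) v \<Longrightarrow> \<nu> \<le> \<mu>"
    using assms(2) unfolding leading_eigenvector_def by blast
  obtain \<nu> v where "eigenpair C (complex_of_real \<nu>) v"
    and \<nu>: "\<And>x. quad_form C x \<le> \<nu> * (norm x)\<^sup>2"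
    using hermitian_top_eigenvector[OF assms(1)] by blast
  then have "\<nu> \<le> \<mu>" using lead by blast
  then have x: "quad_form C x \<le> \<mu> * (norm x)\<^sup>2"
    using \<nu>[of x] by (meson mult_right_mono order_trans zero_le_power2)
  have u: "quad_form C u = \<mu> * (norm u)\<^sup>2"
    using \<mu> by (simp add: eigenpair_def quad_form_eq_inner scaleR_eq_scale[symmetric]
        power2_norm_eq_inner)
  show "quad_form C x * (norm u)\<^sup>2 \<le> quad_form C u * (norm x)\<^sup>2"
    using mult_right_mono[OF x, of "(norm u)\<^sup>2"] by (simp add: u mult_ac)
  show "u \<noteq> 0" using \<mu> by (simp add: eigenpair_def)
qed

section \<open>The torus, global phases and entrywise normalization\<close>

lemma torus_norm:
  assumes "z \<in> torus"
  shows "(norm (z :: complex^'n))\<^sup>2 = real CARD('n)" "norm z = sqrt (real CARD('n))"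
  using assms by (simp_all add: torus_def norm_vec_def L2_set_def)

lemma scale_in_torus: "cmod c = 1 \<Longrightarrow> z \<in> torus \<Longrightarrow> c *s z \<in> torus"
  by (simp add: torus_def norm_mult)

text \<open>\<open>Arg2pi\<close> puts the angle of \<open>c\<close> into the half-open interval of
  the definition, so later estimates can use unimodular factors instead of angles.\<close>

lemma d2_le:
  assumes "cmod c = 1"
  shows "d2 w z \<le> norm (w - c *s z)"
proof -
  have "c = cis (Arg2pi c)"
    using Arg2pi_eq[of c] assms by (simp add: cis_conv_exp)
  moreover have "d2 w z \<le> norm (w - cis (Arg2pi c) *s z)"
    unfolding d2_def
    by (rule cINF_lower) (auto simp: Arg2pi_ge_0 Arg2pi_lt_2pi intro!: bdd_belowI2[where m=0])
  ultimately show ?thesis by simp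
qed

lemma exists_aligning_phase:
  obtains c where "cmod c = 1" "c * x = of_real (cmod x)"
proof (cases "x = 0")
  case True
  show ?thesis by (rule that[of 1]) (use True in auto)
next
  case False
  show ?thesis
  proof (rule that[of "cnj (sgn x)"])
    show "cmod (cnj (sgn x)) = 1" using False by (simp add: norm_sgn)
    show "cnj (sgn x) * x = of_real (cmod x)"
      using False complex_norm_square[of x]
      by (simp add: sgn_div_norm scaleR_conv_of_real field_simps power2_eq_square)
  qed
qed

text \<open>Normalizing moves \<open>x\<close> by its distance to the unit circle, which is at most
  its distance to the point \<open>s\<close> on it. Hence rounding to the torus at most doubles
  distances to torus points.\<close>

lemma cmod_sgn_diff_le:
  assumes "cmod s = 1" "x \<noteq> 0"
  shows "cmod (sgn x - s) \<le> 2 * cmod (x - s)"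
proof -
  have "sgn x - x = sgn x * of_real (1 - cmod x)"
    using assms(2) by (simp add: sgn_div_norm scaleR_conv_of_real field_simps)
  then have "cmod (sgn x - x) = \<bar>cmod x - cmod s\<bar>"
    using assms by (simp only: norm_mult norm_of_real) (simp add: norm_sgn abs_minus_commute)
  also have "\<dots> \<le> cmod (x - s)" by (rule norm_triangle_ineq3)
  finally show ?thesis using norm_triangle_ineq[of "sgn x - x" "x - s"] by simp
qed

lemma outer_product_mult: "outer_product s s *v x = herm_inner s x *s s"
  by (simp add: vec_eq_iff outer_product_def matrix_vector_mult_def herm_inner_def
      sum_distrib_left mult_ac)

lemma quad_form_rank_one_plus:
  "quad_form (outer_product s s + \<Delta>) x = (cmod (herm_inner s x))\<^sup>2 + quad_form \<Delta> x"
proof -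
  have "herm_inner x s = cnj (herm_inner s x)" by (simp add: herm_inner_def mult.commute)
  then have "herm_inner x (herm_inner s x *s s) = of_real ((cmod (herm_inner s x))\<^sup>2)"
    using complex_norm_square[of "herm_inner s x"] by (simp add: herm_inner_scale_right)
  then show ?thesis
    by (simp add: quad_form_def matrix_vector_mult_add_rdistrib outer_product_mult herm_inner_add_right)
qed

lemma hermitian_rank_one_plus: "hermitian \<Delta> \<Longrightarrow> hermitian (outer_product s s + \<Delta>)"
  unfolding hermitian_def hermitian_transpose_def outer_product_def vec_eq_iff
  by (simp add: mult.commute)

lemma norm_vec_square: "(norm (v :: complex^'n))\<^sup>2 = (\<Sum>j\<in>UNIV. (cmod (v $ j))\<^sup>2)"
  by (simp add: norm_vec_def L2_set_def sum_nonneg)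

section \<open>One step of the power method\<close>

lemma entrywise_phase_scaleR:
  assumes "r > 0"
  shows "entrywise_phase (r *\<^sub>R w) = entrywise_phase w"
  using assms by (simp add: entrywise_phase_def vec_eq_iff sgn_scaleR)

lemma entrywise_phase_in_torus: "(\<And>j. w $ j \<noteq> 0) \<Longrightarrow> entrywise_phase w \<in> torus"
  by (simp add: torus_def entrywise_phase_def norm_sgn)

text \<open>Phases ignore the positive factor \<open>\<alpha> / real CARD('n)\<close>, so a step is
  a power step for \<open>C\<close> shifted by its inverse.\<close>

lemma gpm_Suc_eq:
  fixes C :: "complex^'n^'n"
  assumes "\<alpha> > 0"
  shows "gpm C \<alpha> z0 (Suc k) = entrywise_phase
    ((real CARD('n) / \<alpha>) *\<^sub>R gpm C \<alpha> z0 k + C *v gpm C \<alpha> z0 k)"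
proof -
  let ?z = "gpm C \<alpha> z0 k"
  have "(mat 1 + (\<alpha> / real CARD('n)) *\<^sub>R C) *v ?z = ?z + (\<alpha> / real CARD('n)) *\<^sub>R (C *v ?z)"
    by (simp add: matrix_vector_mult_add_rdistrib)
       (simp add: vec_eq_iff matrix_vector_mult_def scaleR_sum_right)
  also have "\<dots> = (\<alpha> / real CARD('n)) *\<^sub>R ((real CARD('n) / \<alpha>) *\<^sub>R ?z + C *v ?z)"
    using assms by (simp add: scaleR_add_right)
  finally show ?thesis using assms by (simp add: entrywise_phase_scaleR)
qed

text \<open>Completing the square: the equal moduli of \<open>x\<close> and \<open>y\<close> cancel
  and only the cross term with \<open>sgn w\<close> survives. A linear term thus becomes a
  comparison of distances to the phase chosen by the power step.\<close>

lemma inner_diff_phase: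
  fixes x y w :: complex
  assumes "cmod x = cmod y"
  shows "2 * ((y - x) \<bullet> w) = cmod w * ((cmod (x - sgn w))\<^sup>2 - (cmod (y - sgn w))\<^sup>2)"
proof -
  have "x \<bullet> x = y \<bullet> y" using assms by (simp add: power2_norm_eq_inner[symmetric])
  then have "(cmod (x - sgn w))\<^sup>2 - (cmod (y - sgn w))\<^sup>2 = 2 * ((y - x) \<bullet> sgn w)"
    by (simp add: power2_norm_eq_inner inner_diff_left inner_diff_right inner_commute)
  moreover have "(y - x) \<bullet> w = cmod w * ((y - x) \<bullet> sgn w)"
    by (cases "w = 0") (simp_all add: sgn_div_norm)
  ultimately show ?thesis by simp
qed

text \<open>All of the convergence analysis comes from this exact expansion of the objective around
  \<open>z\<close>: taken at \<open>y = p\<close> it gives the ascent of one step, at \<open>y\<close> a maximizer it bounds the remaining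
  gap by that ascent, and with a maximizer in the role of \<open>z\<close> it gives quadratic growth.\<close>

lemma quad_form_expansion:
  fixes C :: "complex^'n^'n" and \<beta> :: real
  assumes "hermitian C" "z \<in> torus" "y \<in> torus"
  defines "w \<equiv> \<beta> *\<^sub>R z + C *v z"
  defines "p \<equiv> entrywise_phase w"
  shows "quad_form C y - quad_form C z =
    (\<Sum>j\<in>UNIV. cmod (w $ j) * ((cmod (z $ j - p $ j))\<^sup>2 - (cmod (y $ j - p $ j))\<^sup>2))
    + quad_form C (y - z) + \<beta> * (norm (y - z))\<^sup>2"
proof -
  have "(\<Sum>j\<in>UNIV. cmod (w $ j) * ((cmod (z $ j - p $ j))\<^sup>2 - (cmod (y $ j - p $ j))\<^sup>2))
      = (\<Sum>j\<in>UNIV. 2 * ((y $ j - z $ j) \<bullet> (w $ j)))"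
    using assms(2,3)
    by (intro sum.cong refl, subst inner_diff_phase)
       (auto simp: torus_def p_def entrywise_phase_def)
  also have "\<dots> = 2 * ((y - z) \<bullet> w)"
    by (simp add: inner_vec_def sum_distrib_left)
  also have "\<dots> = 2 * ((y - z) \<bullet> (C *v z)) - \<beta> * (norm (y - z))\<^sup>2"
  proof -
    have "y \<bullet> y = z \<bullet> z"
      using torus_norm(1)[OF assms(2)] torus_norm(1)[OF assms(3)]
      by (simp add: power2_norm_eq_inner)
    \<comment> \<open>Equal norms make the linear contribution of the shift exactly quadratic in
      \<open>y - z\<close>; the last term of the expansion compensates for it.\<close>
    then have "2 * ((y - z) \<bullet> z) = - (norm (y - z))\<^sup>2"
      by (simp add: power2_norm_eq_inner inner_diff_left inner_diff_right inner_commute)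
    then have "2 * (\<beta> * ((y - z) \<bullet> z)) = - (\<beta> * (norm (y - z))\<^sup>2)"
      by (metis mult.left_commute mult_minus_right)
    then show ?thesis by (simp add: w_def inner_add_right algebra_simps)
  qed
  finally show ?thesis
    using hermitian_inner_adjoint[OF assms(1), of z y]
    by (simp add: quad_form_eq_inner matrix_vector_mult_diff_distrib inner_diff_left
        inner_diff_right inner_commute)
qed

section \<open>The synchronization region\<close>

locale phase_synchronization =
  fixes s :: "complex^'n" and \<Delta> :: "complex^'n^'n" and N :: real
  assumes N_def: "N = real CARD('n)"
    and s_torus: "s \<in> torus"
    and hermitian_noise: "hermitian \<Delta>"
    and op_norm_noise: "op_norm \<Delta> \<le> N powr (3 / 4) / 312"
    and linf_noise: "linf_norm (\<Delta> *v s) \<le> N / 24"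
begin

abbreviation E :: real where "E \<equiv> op_norm \<Delta>"
abbreviation C :: "complex^'n^'n" where "C \<equiv> outer_product s s + \<Delta>"
abbreviation f :: "complex^'n \<Rightarrow> real" where "f \<equiv> quad_form C"
abbreviation aligned :: "complex^'n \<Rightarrow> bool" where
  "aligned x \<equiv> herm_inner s x = complex_of_real (cmod (herm_inner s x))"

text \<open>The slack \<open>80 * E\<^sup>2\<close> is what the eigenvector estimator may lose
  against \<open>s\<close>: 64 from the signal and 16 from the noise. A superlevel set is preserved
  by any torus-valued step that does not decrease \<open>f\<close>.\<close>

definition region :: "(complex^'n) set" where
  "region = {z \<in> torus. f s - 80 * E\<^sup>2 \<le> f z}"

lemma N_ge_1: "N \<ge> 1"
  using zero_less_card_finite[where 'a = 'n] by (simp add: N_def Suc_le_eq)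

lemma N_nonneg [simp]: "0 \<le> N"
  using N_ge_1 by simp

lemma sqrt_N_sqrt_N [simp]: "(sqrt N)\<^sup>2 = N" "sqrt N * (sqrt N * x) = N * x"
  by (simp_all add: mult.assoc[symmetric])

lemma torus_norm_N: "z \<in> torus \<Longrightarrow> (norm z)\<^sup>2 = N" "z \<in> torus \<Longrightarrow> norm z = sqrt N"
  for z :: "complex^'n"
  by (simp_all add: torus_norm N_def)

lemma E_nonneg: "0 \<le> E"
  by (rule op_norm_nonneg)

lemma hermitian_C: "hermitian C"
  using hermitian_noise by (rule hermitian_rank_one_plus)

text \<open>This is where the exponent 3/4 matters: at distance of order \<open>E / sqrt N\<close>
  from \<open>s\<close>, the product of \<open>E\<close> and the distance is then a small multiple
  of \<open>N\<close>. Here 97344 is the square of 312.\<close>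

lemma E_square_le: "E\<^sup>2 \<le> N * sqrt N / 97344"
proof -
  have "E\<^sup>2 \<le> (N powr (3 / 4) / 312)\<^sup>2"
    by (rule power_mono[OF op_norm_noise E_nonneg])
  also have "\<dots> = N powr (3 / 2) / 97344"
    by (simp add: power_divide power2_eq_square powr_add[symmetric])
  also have "N powr (3 / 2) = N * sqrt N"
    using powr_add[of N 1 "1 / 2"] N_ge_1 by (simp add: powr_half_sqrt)
  finally show ?thesis .
qed

lemma sqrt_N_le: "sqrt N \<le> N"
  using N_ge_1 by (intro real_le_lsqrt) (simp_all add: power2_eq_square)

lemma E_le: "E \<le> N / 312"
proof -
  have "N powr (3 / 4) \<le> N powr 1"
    using N_ge_1 by (intro powr_mono) auto
  with op_norm_noise show ?thesis using N_ge_1 by simp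
qed

section \<open>Distance to the signal from the objective value\<close>

text \<open>By symmetry the difference of the two forms factors like a difference of squares, into
  \<open>x - s\<close> and \<open>x + s\<close>, and the latter has norm at most
  \<open>2 * sqrt N\<close>.\<close>

lemma noise_form_diff_le:
  assumes "(norm x)\<^sup>2 = N"
  shows "\<bar>quad_form \<Delta> x - quad_form \<Delta> s\<bar> \<le> 2 * sqrt N * E * norm (x - s)"
proof -
  have nx: "norm x = sqrt N" using assms real_sqrt_unique[of "norm x" N] by simp
  have "quad_form \<Delta> x - quad_form \<Delta> s = (x - s) \<bullet> (\<Delta> *v (x + s))"
    using hermitian_inner_adjoint[OF hermitian_noise, of x s]
    by (simp add: quad_form_eq_inner matrix_vector_right_distrib inner_diff_left
        inner_add_right inner_commute[of "\<Delta> *v x" s])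
  then have "\<bar>quad_form \<Delta> x - quad_form \<Delta> s\<bar> \<le> E * norm (x - s) * norm (x + s)"
    using abs_inner_matrix_le[of "x - s" \<Delta> "x + s"] by simp
  also have "\<dots> \<le> E * norm (x - s) * (2 * sqrt N)"
    using norm_triangle_ineq[of x s] nx torus_norm_N(2)[OF s_torus] E_nonneg
    by (intro mult_left_mono) auto
  finally show ?thesis by (simp add: mult_ac)
qed

lemma f_eq: "f x = (cmod (herm_inner s x))\<^sup>2 + quad_form \<Delta> x"
  by (rule quad_form_rank_one_plus)

lemma f_s: "f s = N\<^sup>2 + quad_form \<Delta> s"
  using torus_norm_N(1)[OF s_torus] by (simp add: f_eq herm_inner_self)

lemma Re_herm_inner_eq:
  assumes "(norm x)\<^sup>2 = N"
  shows "Re (herm_inner s x) = N - (norm (x - s))\<^sup>2 / 2"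
  using assms torus_norm_N(1)[OF s_torus]
  by (simp add: inner_eq_Re_herm_inner[symmetric] power2_norm_eq_inner inner_diff_left
      inner_diff_right inner_commute diff_divide_distrib)

lemma aligned_cmod:
  assumes "(norm x)\<^sup>2 = N" "aligned x"
  shows "cmod (herm_inner s x) = N - (norm (x - s))\<^sup>2 / 2"
  using Re_herm_inner_eq[OF assms(1)] assms(2) by (metis Re_complex_of_real)

text \<open>At distance \<open>d\<close> the signal part loses at least
  \<open>N * d\<^sup>2 / 2\<close>, while the noise part gains at most
  \<open>2 * sqrt N * E * d\<close>. Only the norm of \<open>x\<close> is fixed, so that a rescaled
  eigenvector is covered too.\<close>

lemma superlevel_distance:
  assumes "(norm x)\<^sup>2 = N" "aligned x" "f s - \<delta> \<le> f x"
  shows "N * (norm (x - s))\<^sup>2 \<le> 4 * sqrt N * E * norm (x - s) + 2 * \<delta>"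
proof -
  let ?d = "norm (x - s)"
  define H where "H = cmod (herm_inner s x)"
  have H: "H = N - ?d\<^sup>2 / 2" "0 \<le> H"
    unfolding H_def by (rule aligned_cmod[OF assms(1,2)]) simp
  have "N\<^sup>2 - H\<^sup>2 \<le> 2 * sqrt N * E * ?d + \<delta>"
    using assms(3) noise_form_diff_le[OF assms(1)] by (simp add: f_s f_eq[of x] H_def)
  moreover have "N\<^sup>2 - H\<^sup>2 = (?d\<^sup>2 / 2) * (N + H)"
    by (simp add: H(1) power2_eq_square algebra_simps)
  moreover have "(?d\<^sup>2 / 2) * N \<le> (?d\<^sup>2 / 2) * (N + H)"
    using H(2) by (intro mult_left_mono) auto
  ultimately show ?thesis by (simp add: algebra_simps)
qed

lemma align:
  obtains c where "cmod c = 1" "aligned (c *s x)"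
proof -
  obtain c where c: "cmod c = 1" "c * herm_inner s x = of_real (cmod (herm_inner s x))"
    by (rule exists_aligning_phase)
  have "aligned (c *s x)"
    using c by (simp add: herm_inner_scale_right)
  with c(1) show ?thesis by (rule that)
qed

lemma maximal_distance:
  assumes "(norm x)\<^sup>2 = N" "aligned x" "f s \<le> f x"
  shows "sqrt N * norm (x - s) \<le> 4 * E"
proof (cases "norm (x - s) = 0")
  case False
  have "N * (norm (x - s))\<^sup>2 \<le> 4 * sqrt N * E * norm (x - s)"
    using superlevel_distance[of x 0] assms by simp
  then have "(sqrt N * norm (x - s)) * (sqrt N * norm (x - s)) \<le> (4 * E) * (sqrt N * norm (x - s))"
    by (simp add: power2_eq_square mult_ac)
  moreover have "0 < sqrt N * norm (x - s)" using False N_ge_1 by simp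
  ultimately show ?thesis by (simp only: mult_le_cancel_right_pos)
qed (simp add: E_nonneg)

lemma region_distance:
  assumes "x \<in> region" "aligned x"
  shows "sqrt N * norm (x - s) \<le> 15 * E"
proof (rule ccontr)
  define t where "t = sqrt N * norm (x - s)"
  assume "\<not> ?thesis"
  then have t: "t > 15 * E" by (simp add: t_def)
  have "N * (norm (x - s))\<^sup>2 \<le> 4 * sqrt N * E * norm (x - s) + 2 * (80 * E\<^sup>2)"
    using assms torus_norm_N(1)[of x] by (intro superlevel_distance) (auto simp: region_def)
  moreover have "N * (norm (x - s))\<^sup>2 = t\<^sup>2"
    by (simp add: t_def power_mult_distrib)
  ultimately have "t\<^sup>2 \<le> 4 * E * t + 160 * E\<^sup>2"
    by (simp add: t_def mult_ac)
  \<comment> \<open>The positive root of \<open>t\<^sup>2 = 4 * E * t + 160 * E\<^sup>2\<close> is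
    about \<open>14.8 * E\<close>; rounding it up to \<open>15 * E\<close> gives this
    factorization.\<close>
  then have "(t - 15 * E) * (t + 11 * E) \<le> - 5 * E\<^sup>2"
    by (simp add: power2_eq_square algebra_simps)
  moreover have "0 < (t - 15 * E) * (t + 11 * E)"
    using t E_nonneg by (intro mult_pos_pos) auto
  moreover have "0 \<le> E\<^sup>2" by simp
  ultimately show False by linarith
qed

text \<open>The constants round \<open>225 / 97344\<close> and \<open>15 / 97344\<close>
  upwards.\<close>

lemma region_distance_bounds:
  assumes "x \<in> region" "aligned x"
  shows "(norm (x - s))\<^sup>2 \<le> N / 400" "E * norm (x - s) \<le> N / 5000"
proof -
  define d where "d = norm (x - s)"
  have d: "sqrt N * d \<le> 15 * E" "0 \<le> d"
    using region_distance[OF assms] by (auto simp: d_def)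
  have "(sqrt N * d)\<^sup>2 \<le> (15 * E)\<^sup>2"
    using d N_ge_1 by (intro power_mono) auto
  then have "N * d\<^sup>2 \<le> 225 * E\<^sup>2" by (simp add: power_mult_distrib)
  also have "\<dots> \<le> N * sqrt N * (225 / 97344)" using E_square_le by simp
  also have "\<dots> \<le> N * N / 400"
    using mult_left_mono[OF sqrt_N_le, of N] N_ge_1 by simp
  finally have "N * d\<^sup>2 \<le> N * (N / 400)" by simp
  then show "(norm (x - s))\<^sup>2 \<le> N / 400" using N_ge_1 by (simp add: d_def)
  have "sqrt N * (E * d) \<le> 15 * E\<^sup>2"
    using mult_left_mono[OF d(1) E_nonneg] by (simp add: power2_eq_square mult_ac)
  also have "\<dots> \<le> sqrt N * (N * (15 / 97344))" using E_square_le by simp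
  also have "\<dots> \<le> sqrt N * (N / 5000)" using N_ge_1 by (intro mult_left_mono) auto
  finally show "E * norm (x - s) \<le> N / 5000" using N_ge_1 by (simp add: d_def)
qed

text \<open>The leading eigenvector, rescaled to norm \<open>sqrt N\<close> and aligned, has value
  at least \<open>f s\<close> and so lies within \<open>4 * E / sqrt N\<close> of \<open>s\<close>.
  Rounding to the torus doubles this, and at distance \<open>8 * E / sqrt N\<close> the objective is
  at most \<open>(64 + 16) * E\<^sup>2\<close> below \<open>f s\<close>.\<close>

lemma eigenvector_estimator_in_region:
  assumes "leading_eigenvector C u" "herm_inner a' u \<noteq> 0"
  shows "eigenvector_estimator a' u \<in> region"
proof -
  let ?v = "eigenvector_estimator a' u"
  have u0: "u \<noteq> 0" by (rule leading_eigenvector_quad_form_ge(2)[OF hermitian_C assms(1)])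
  define r where "r = sqrt N / norm u"
  have r: "r > 0" using u0 N_ge_1 by (simp add: r_def)
  obtain c where c: "cmod c = 1" "aligned (c *s (r *\<^sub>R u))" by (rule align)
  define x where "x = c *s (r *\<^sub>R u)"
  have nx: "(norm x)\<^sup>2 = N"
    using u0 N_ge_1 by (simp add: x_def norm_scale_unimodular[OF c(1)] r_def)
  have fx: "f x = r\<^sup>2 * f u"
    by (simp add: x_def quad_form_scale_unimodular[OF c(1)])
       (simp add: quad_form_eq_inner matrix_vector_mult_scaleR power2_eq_square)
  have "f s * (norm u)\<^sup>2 \<le> f u * N"
    using leading_eigenvector_quad_form_ge(1)[OF hermitian_C assms(1), of s] torus_norm_N(1)[OF s_torus]
    by simp
  then have "f s \<le> (f u * N) / (norm u)\<^sup>2"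
    using u0 by (subst pos_le_divide_eq) auto
  then have "f s \<le> f x"
    unfolding fx by (simp add: r_def power_divide mult.commute)
  then have dx: "sqrt N * norm (x - s) \<le> 4 * E"
    using nx c(2) by (intro maximal_distance) (auto simp: x_def)
  have vt: "?v \<in> torus"
    using assms(2) by (simp add: torus_def eigenvector_estimator_def norm_sgn)
  define y where "y = c *s ?v"
  have ny: "(norm y)\<^sup>2 = N"
    using torus_norm_N(1)[OF vt] by (simp add: y_def norm_scale_unimodular[OF c(1)])
  have "cmod (y $ j - s $ j) \<le> 2 * cmod (x $ j - s $ j)" for j
  proof -
    have sj: "cmod (s $ j) = 1" using s_torus by (simp add: torus_def)
    have yj: "cmod (y $ j) = 1" using vt c(1) by (simp add: y_def torus_def norm_mult)
    show ?thesis
    proof (cases "u $ j = 0")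
      \<comment> \<open>Here \<open>x $ j = 0\<close> is at distance 1 from \<open>s $ j\<close>, so
        any unimodular fallback value is good enough.\<close>
      case True
      then show ?thesis
        using norm_triangle_ineq4[of "y $ j" "s $ j"] sj yj by (simp add: x_def)
    next
      case False
      have sgnc: "sgn c = c" using c(1) by (simp add: sgn_div_norm)
      have "y $ j = sgn (x $ j)"
        using False r by (simp add: y_def x_def eigenvector_estimator_def sgn_mult sgnc sgn_scaleR)
      moreover have "x $ j \<noteq> 0" using False r c(1) by (auto simp: x_def)
      ultimately show ?thesis using cmod_sgn_diff_le[OF sj] by simp
    qed
  qed
  then have "(norm (y - s))\<^sup>2 \<le> (2 * norm (x - s))\<^sup>2"
    unfolding power_mult_distrib norm_vec_square sum_distrib_left
    by (intro sum_mono) (metis norm_ge_zero power_mono power_mult_distrib vector_minus_component)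
  then have "norm (y - s) \<le> 2 * norm (x - s)"
    by (rule power2_le_imp_le) simp
  then have "sqrt N * norm (y - s) \<le> sqrt N * (2 * norm (x - s))"
    by (intro mult_left_mono) auto
  with dx have dy: "sqrt N * norm (y - s) \<le> 8 * E" by simp
  define d where "d = norm (y - s)"
  have "(sqrt N * d)\<^sup>2 \<le> (8 * E)\<^sup>2"
    using dy N_ge_1 by (intro power_mono) (auto simp: d_def)
  then have d2: "N * d\<^sup>2 \<le> 64 * E\<^sup>2" by (simp add: power_mult_distrib)
  \<comment> \<open>The phase \<open>c\<close> aligns \<open>x\<close>, not \<open>y\<close>, so
    only the real part of \<open>herm_inner s y\<close> is known exactly.\<close>
  have "\<bar>N - d\<^sup>2 / 2\<bar> \<le> cmod (herm_inner s y)"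
    using abs_Re_le_cmod[of "herm_inner s y"] Re_herm_inner_eq[OF ny] by (simp add: d_def)
  then have "(N - d\<^sup>2 / 2)\<^sup>2 \<le> (cmod (herm_inner s y))\<^sup>2"
    by (metis abs_ge_zero power2_abs power_mono)
  moreover have "(N - d\<^sup>2 / 2)\<^sup>2 = N\<^sup>2 - N * d\<^sup>2 + (d\<^sup>2 / 2)\<^sup>2"
    by (simp add: power2_eq_square algebra_simps)
  ultimately have A: "N\<^sup>2 - 64 * E\<^sup>2 \<le> (cmod (herm_inner s y))\<^sup>2"
    using d2 zero_le_power2[of "d\<^sup>2 / 2"] by linarith
  have "E * (sqrt N * d) \<le> E * (8 * E)"
    using dy E_nonneg by (intro mult_left_mono) (auto simp: d_def)
  then have "2 * sqrt N * E * d \<le> 16 * E\<^sup>2" by (simp add: power2_eq_square mult_ac)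
  with noise_form_diff_le[OF ny] have "quad_form \<Delta> s - quad_form \<Delta> y \<le> 16 * E\<^sup>2"
    by (simp add: d_def)
  with A have "f s - 80 * E\<^sup>2 \<le> f y" by (simp add: f_s f_eq[of y])
  then have "f s - 80 * E\<^sup>2 \<le> f ?v"
    by (simp add: y_def quad_form_scale_unimodular[OF c(1)])
  with vt show ?thesis by (simp add: region_def)
qed

section \<open>Entries of the power step and curvature inside the region\<close>

lemma scale_in_region:
  assumes "z \<in> region" "cmod c = 1"
  shows "c *s z \<in> region"
  using assms by (simp add: region_def scale_in_torus quad_form_scale_unimodular)

lemma linf_noise_entry: "cmod ((\<Delta> *v s) $ j) \<le> N / 24"
proof -
  have "cmod ((\<Delta> *v s) $ j) \<le> linf_norm (\<Delta> *v s)"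
    unfolding linf_norm_def by (rule Max_ge) auto
  with linf_noise show ?thesis by linarith
qed

text \<open>After alignment the signal entry is at least \<open>N - N / 800\<close>. The noise is
  split at \<open>s\<close>: the entrywise bound controls \<open>\<Delta> *v s\<close>, the operator
  norm controls the rest since \<open>y\<close> is near \<open>s\<close>. This leaves
  \<open>0.95 * N\<close>, from which the shift takes at most \<open>N / 4\<close>.\<close>

lemma power_step_entry_ge:
  assumes "z \<in> region" "0 \<le> \<beta>" "\<beta> \<le> N / 4"
  shows "7 / 10 * N \<le> cmod ((\<beta> *\<^sub>R z + C *v z) $ j)"
proof -
  obtain c where c: "cmod c = 1" "aligned (c *s z)" by (rule align)
  define y where "y = c *s z"
  have y: "y \<in> region" "aligned y"
    using scale_in_region[OF assms(1) c(1)] c(2) by (auto simp: y_def)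
  note db = region_distance_bounds[OF y]
  have yt: "y \<in> torus" using y by (simp add: region_def)
  have sj: "cmod (s $ j) = 1" using s_torus by (simp add: torus_def)
  have "(\<Delta> *v y) $ j = (\<Delta> *v s) $ j + (\<Delta> *v (y - s)) $ j"
    by (simp add: matrix_vector_mult_diff_distrib)
  moreover have "cmod ((\<Delta> *v (y - s)) $ j) \<le> E * norm (y - s)"
    using Finite_Cartesian_Product.norm_nth_le[of "\<Delta> *v (y - s)" j] norm_matrix_vector_mult_le[of \<Delta> "y - s"]
    by (rule order_trans)
  ultimately have noise: "cmod ((\<Delta> *v y) $ j) \<le> N / 24 + N / 5000"
    using linf_noise_entry[of j] db(2) norm_triangle_ineq[of "(\<Delta> *v s) $ j" "(\<Delta> *v (y - s)) $ j"]
    by simp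
  have "cmod ((C *v y) $ j) \<ge> cmod (herm_inner s y) - cmod ((\<Delta> *v y) $ j)"
    using norm_diff_ineq[of "herm_inner s y * s $ j" "(\<Delta> *v y) $ j"] sj
    by (simp add: matrix_vector_mult_add_rdistrib outer_product_mult norm_mult)
  with noise aligned_cmod[OF torus_norm_N(1)[OF yt] y(2)] db(1)
  have "cmod ((C *v y) $ j) \<ge> 95 / 100 * N" using N_ge_1 by simp
  moreover have "cmod ((\<beta> *\<^sub>R y) $ j) \<le> N / 4"
    using assms(2,3) yt by (simp add: torus_def)
  ultimately have "7 / 10 * N \<le> cmod ((\<beta> *\<^sub>R y + C *v y) $ j)"
    using norm_diff_ineq[of "(C *v y) $ j" "(\<beta> *\<^sub>R y) $ j"] N_ge_1 by (simp add: add.commute)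
  also have "(\<beta> *\<^sub>R y + C *v y) $ j = c * (\<beta> *\<^sub>R z + C *v z) $ j"
    by (simp add: y_def vector_scalar_commute scaleR_conv_of_real[where 'a = complex] algebra_simps)
  finally show ?thesis by (simp add: norm_mult c(1))
qed

text \<open>Both inner products with \<open>s\<close> being real, \<open>herm_inner s (y - z)\<close> is the difference of two
  squared distances and hence of smaller order than \<open>norm (y - z)\<close>.\<close>

lemma quad_form_aligned_diff_le:
  assumes "z \<in> region" "aligned z" "y \<in> region" "aligned y"
  shows "f (y - z) \<le> N / 100 * (norm (y - z))\<^sup>2"
proof -
  define h where "h = norm (y - z)"
  define dz where "dz = norm (z - s)"
  define dy where "dy = norm (y - s)"
  have t: "(norm z)\<^sup>2 = N" "(norm y)\<^sup>2 = N"
    using assms by (auto simp: region_def torus_norm_N)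
  have "herm_inner s (y - z) = of_real (cmod (herm_inner s y) - cmod (herm_inner s z))"
    using assms by (simp add: herm_inner_diff_right)
  then have "cmod (herm_inner s (y - z)) = \<bar>cmod (herm_inner s y) - cmod (herm_inner s z)\<bar>"
    by (simp only: norm_of_real)
  also have "cmod (herm_inner s y) - cmod (herm_inner s z) = (dz - dy) * ((dz + dy) / 2)"
    unfolding aligned_cmod[OF t(1) assms(2)] aligned_cmod[OF t(2) assms(4)]
    by (simp add: dz_def dy_def power2_eq_square field_simps)
  also have "\<bar>(dz - dy) * ((dz + dy) / 2)\<bar> = \<bar>dz - dy\<bar> * ((dz + dy) / 2)"
    by (simp add: abs_mult dz_def dy_def)
  also have "\<dots> \<le> h * ((dz + dy) / 2)"
  proof (rule mult_right_mono)
    show "\<bar>dz - dy\<bar> \<le> h"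
      using norm_triangle_ineq3[of "z - s" "y - s"] by (simp add: dz_def dy_def h_def norm_minus_commute)
  qed (simp add: dz_def dy_def)
  finally have "(cmod (herm_inner s (y - z)))\<^sup>2 \<le> (h * ((dz + dy) / 2))\<^sup>2"
    by (rule power_mono) simp
  also have "\<dots> = h\<^sup>2 * ((dz + dy) / 2)\<^sup>2" by (rule power_mult_distrib)
  also have "\<dots> \<le> h\<^sup>2 * (N / 400)"
  proof (rule mult_left_mono)
    have "((dz + dy) / 2)\<^sup>2 \<le> (dz\<^sup>2 + dy\<^sup>2) / 2"
      using zero_le_power2[of "dz - dy"] by (simp add: power2_eq_square field_simps)
    then show "((dz + dy) / 2)\<^sup>2 \<le> N / 400"
      using region_distance_bounds(1)[OF assms(1,2)] region_distance_bounds(1)[OF assms(3,4)]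
      by (simp add: dz_def dy_def)
  qed simp
  finally have A: "(cmod (herm_inner s (y - z)))\<^sup>2 \<le> h\<^sup>2 * (N / 400)" .
  have "quad_form \<Delta> (y - z) \<le> E * h * h"
    using abs_inner_matrix_le[of "y - z" \<Delta> "y - z"] by (simp add: quad_form_eq_inner h_def)
  also have "\<dots> \<le> (N / 312) * h * h"
    using E_le by (intro mult_right_mono) (auto simp: h_def)
  finally have B: "quad_form \<Delta> (y - z) \<le> h\<^sup>2 * (N / 312)"
    by (simp add: power2_eq_square mult_ac)
  have "f (y - z) \<le> h\<^sup>2 * (N / 400 + N / 312)"
    using A B by (simp add: f_eq distrib_left)
  also have "\<dots> \<le> h\<^sup>2 * (N / 100)"
    using N_ge_1 by (intro mult_left_mono) auto
  finally show ?thesis by (simp add: h_def mult.commute)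
qed

end

section \<open>Ascent, contraction and quadratic growth\<close>

text \<open>\<open>\<beta>\<close> stands for \<open>n / \<alpha>\<close>. The lower bound makes the
  shifted matrix positive semidefinite, which gives monotonicity; the upper bound is
  \<open>\<alpha> \<ge> 4\<close> and keeps the shift small against the weights.\<close>

locale power_step = phase_synchronization s \<Delta> N for s :: "complex^'n" and \<Delta> N +
  fixes \<beta> :: real
  assumes \<beta>_ge: "op_norm \<Delta> \<le> \<beta>" and \<beta>_le: "\<beta> \<le> N / 4"
begin

definition weight :: "complex^'n \<Rightarrow> 'n \<Rightarrow> real" where
  "weight z j = cmod ((\<beta> *\<^sub>R z + C *v z) $ j)"

definition step :: "complex^'n \<Rightarrow> complex^'n" where
  "step z = entrywise_phase (\<beta> *\<^sub>R z + C *v z)"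

text \<open>The weighted sum of \<open>quad_form_expansion\<close> at \<open>y = step z\<close>,
  where the second squares vanish.\<close>

definition ascent :: "complex^'n \<Rightarrow> real" where
  "ascent z = (\<Sum>j\<in>UNIV. weight z j * (cmod (z $ j - step z $ j))\<^sup>2)"

lemma weight_ge: "z \<in> region \<Longrightarrow> 7 / 10 * N \<le> weight z j"
  unfolding weight_def using E_nonneg \<beta>_ge \<beta>_le by (intro power_step_entry_ge) auto

lemma ascent_ge:
  assumes "z \<in> region"
  shows "7 / 10 * N * (norm (z - step z))\<^sup>2 \<le> ascent z"
  unfolding ascent_def norm_vec_square sum_distrib_left
  by (intro sum_mono) (use weight_ge[OF assms] in \<open>simp add: mult_right_mono del: times_divide_eq_left\<close>)

text \<open>Besides the ascent, the expansion at \<open>step z\<close> leaves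
  \<open>f h + \<beta> * (norm h)\<^sup>2\<close>. It is nonnegative because the signal part of
  \<open>f h\<close> is a square and the noise part is at least
  \<open>- E * (norm h)\<^sup>2\<close>.\<close>

lemma f_step_ge:
  assumes "z \<in> region"
  shows "f z + ascent z \<le> f (step z)" "step z \<in> region"
proof -
  have zt: "z \<in> torus" using assms by (simp add: region_def)
  have pt: "step z \<in> torus"
    unfolding step_def
  proof (rule entrywise_phase_in_torus)
    fix j show "(\<beta> *\<^sub>R z + C *v z) $ j \<noteq> 0"
      using weight_ge[OF assms, of j] N_ge_1 by (auto simp: weight_def)
  qed
  define h where "h = step z - z"
  have eq: "f (step z) - f z = ascent z + f h + \<beta> * (norm h)\<^sup>2"
    using quad_form_expansion[OF hermitian_C zt pt, of \<beta>]
    by (simp add: ascent_def weight_def step_def h_def)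
  have "- (\<beta> * (norm h)\<^sup>2) \<le> - (E * (norm h)\<^sup>2)"
    using \<beta>_ge by (simp add: mult_right_mono)
  also have "\<dots> \<le> quad_form \<Delta> h"
    using abs_inner_matrix_le[of h \<Delta> h]
    by (simp add: quad_form_eq_inner power2_eq_square mult_ac)
  also have "\<dots> \<le> f h" by (simp add: f_eq)
  finally show le: "f z + ascent z \<le> f (step z)" using eq by simp
  have "0 \<le> ascent z" by (auto simp: ascent_def weight_def intro!: sum_nonneg)
  with le assms pt show "step z \<in> region" by (simp add: region_def)
qed

text \<open>The small curvature bound needs both points aligned with \<open>s\<close>, hence the
  relative phase \<open>c\<close>. The constant adds 1/100 from \<open>C\<close> and 1/4 from the
  shift.\<close>

lemma f_diff_le:
  assumes "z \<in> region" "y \<in> region"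
  obtains c where "cmod c = 1"
    "f y - f z \<le> (\<Sum>j\<in>UNIV. weight z j *
        ((cmod (z $ j - step z $ j))\<^sup>2 - (cmod ((c *s y) $ j - step z $ j))\<^sup>2))
      + 26 / 100 * N * (norm (c *s y - z))\<^sup>2"
proof -
  obtain cz where cz: "cmod cz = 1" "aligned (cz *s z)" by (rule align)
  obtain cy where cy: "cmod cy = 1" "aligned (cy *s y)" by (rule align)
  define c where "c = cnj cz * cy"
  have c: "cmod c = 1" using cz cy by (simp add: c_def norm_mult)
  \<comment> \<open>Only \<open>y\<close> is rotated, since weights and step belong to
    \<open>z\<close>; a common rotation by \<open>cz\<close> then reaches the aligned pair.\<close>
  have "cz *s (c *s y - z) = cy *s y - cz *s z"
    using cnj_mult_unimodular(2)[OF cz(1)]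
    by (simp add: c_def vec_eq_iff algebra_simps)
  then have "f (c *s y - z) \<le> N / 100 * (norm (c *s y - z))\<^sup>2"
    using quad_form_aligned_diff_le[OF scale_in_region[OF assms(1) cz(1)] cz(2)
        scale_in_region[OF assms(2) cy(1)] cy(2)]
    by (metis quad_form_scale_unimodular[OF cz(1)] norm_scale_unimodular[OF cz(1)])
  moreover have "\<beta> * (norm (c *s y - z))\<^sup>2 \<le> N / 4 * (norm (c *s y - z))\<^sup>2"
    using \<beta>_le by (intro mult_right_mono) auto
  moreover have "f (c *s y) - f z = (\<Sum>j\<in>UNIV. weight z j *
        ((cmod (z $ j - step z $ j))\<^sup>2 - (cmod ((c *s y) $ j - step z $ j))\<^sup>2))
      + f (c *s y - z) + \<beta> * (norm (c *s y - z))\<^sup>2"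
    unfolding weight_def step_def using assms scale_in_region[OF assms(2) c]
    by (intro quad_form_expansion[OF hermitian_C]) (auto simp: region_def)
  ultimately show ?thesis
    using that[OF c] by (simp add: quad_form_scale_unimodular[OF c])
qed

text \<open>The negative squares at \<open>y\<close> are traded for distances to \<open>z\<close>
  through \<open>(a + b)\<^sup>2 \<le> 2 * a\<^sup>2 + 2 * b\<^sup>2\<close>. This doubles the
  ascent and yields \<open>- 0.35 * N * (norm h)\<^sup>2\<close>, which absorbs the curvature term
  with constant 0.26.\<close>

lemma gap_le_ascent:
  assumes "z \<in> region" "y \<in> region"
  shows "f y - f z \<le> 2 * ascent z"
proof -
  obtain c where c: "cmod c = 1"
    "f y - f z \<le> (\<Sum>j\<in>UNIV. weight z j *
        ((cmod (z $ j - step z $ j))\<^sup>2 - (cmod ((c *s y) $ j - step z $ j))\<^sup>2))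
      + 26 / 100 * N * (norm (c *s y - z))\<^sup>2"
    using f_diff_le[OF assms] .
  define h where "h = c *s y - z"
  have "weight z j * ((cmod (z $ j - step z $ j))\<^sup>2 - (cmod ((c *s y) $ j - step z $ j))\<^sup>2)
      \<le> 2 * (weight z j * (cmod (z $ j - step z $ j))\<^sup>2) - 35 / 100 * N * (cmod (h $ j))\<^sup>2" for j
  proof -
    let ?a = "cmod (z $ j - step z $ j)" and ?b = "cmod ((c *s y) $ j - step z $ j)"
    have "cmod (h $ j) \<le> ?b + ?a"
      using norm_triangle_ineq4[of "(c *s y) $ j - step z $ j" "z $ j - step z $ j"]
      by (simp add: h_def)
    then have "(cmod (h $ j))\<^sup>2 \<le> (?b + ?a)\<^sup>2" by (intro power_mono) auto
    also have "\<dots> \<le> 2 * ?a\<^sup>2 + 2 * ?b\<^sup>2"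
      using zero_le_power2[of "?a - ?b"] by (simp add: power2_eq_square algebra_simps)
    finally have "?a\<^sup>2 - ?b\<^sup>2 \<le> 2 * ?a\<^sup>2 - (cmod (h $ j))\<^sup>2 / 2" by simp
    then have "weight z j * (?a\<^sup>2 - ?b\<^sup>2) \<le> weight z j * (2 * ?a\<^sup>2 - (cmod (h $ j))\<^sup>2 / 2)"
      by (intro mult_left_mono) (auto simp: weight_def)
    moreover have "7 / 10 * N * ((cmod (h $ j))\<^sup>2 / 2) \<le> weight z j * ((cmod (h $ j))\<^sup>2 / 2)"
      by (intro mult_right_mono weight_ge assms) auto
    ultimately show ?thesis by (simp add: algebra_simps)
  qed
  then have "(\<Sum>j\<in>UNIV. weight z j *
        ((cmod (z $ j - step z $ j))\<^sup>2 - (cmod ((c *s y) $ j - step z $ j))\<^sup>2))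
      \<le> (\<Sum>j\<in>UNIV. 2 * (weight z j * (cmod (z $ j - step z $ j))\<^sup>2)
            - 35 / 100 * N * (cmod (h $ j))\<^sup>2)"
    by (intro sum_mono)
  also have "\<dots> = 2 * ascent z - 35 / 100 * N * (norm h)\<^sup>2"
    unfolding ascent_def norm_vec_square sum_subtractf sum_distrib_left ..
  finally have "f y - f z \<le> 2 * ascent z - 9 / 100 * (N * (norm h)\<^sup>2)"
    using c(2) by (simp add: h_def algebra_simps)
  moreover have "0 \<le> N * (norm h)\<^sup>2" by simp
  ultimately show ?thesis by linarith
qed

lemma step_contracts:
  assumes "z \<in> region" "y \<in> region"
  shows "f y - f (step z) \<le> (f y - f z) / 2"
  using gap_le_ascent[OF assms] f_step_ge(1)[OF assms(1)] by simp

lemma maximizer_in_region: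
  assumes "global_maximizer_on f torus y"
  shows "y \<in> region"
proof -
  have "f s - 80 * E\<^sup>2 \<le> f s" by simp
  also have "f s \<le> f y" using assms s_torus by (simp add: global_maximizer_on_def)
  finally show ?thesis using assms by (simp add: region_def global_maximizer_on_def)
qed

text \<open>A maximizer cannot gain, so its ascent is zero and it is a fixed point of
  \<open>step\<close>. In the expansion around it the first squares vanish, and weights of at least
  \<open>0.7 * N\<close> minus the curvature 0.26 leave 0.44.\<close>

lemma quadratic_growth:
  assumes "global_maximizer_on f torus y" "z \<in> region"
  shows "44 / 100 * N * (d2 z y)\<^sup>2 \<le> f y - f z"
proof -
  have yr: "y \<in> region" by (rule maximizer_in_region[OF assms(1)])
  have "f (step y) \<le> f y"
    using f_step_ge(2)[OF yr] assms(1) by (auto simp: global_maximizer_on_def region_def)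
  then have "7 / 10 * N * (norm (y - step y))\<^sup>2 \<le> 0"
    using f_step_ge(1)[OF yr] ascent_ge[OF yr] by linarith
  then have fixpoint: "step y = y"
    using N_ge_1 by (simp add: mult_le_0_iff)
  obtain c where c: "cmod c = 1"
    "f z - f y \<le> (\<Sum>j\<in>UNIV. weight y j *
        ((cmod (y $ j - step y $ j))\<^sup>2 - (cmod ((c *s z) $ j - step y $ j))\<^sup>2))
      + 26 / 100 * N * (norm (c *s z - y))\<^sup>2"
    using f_diff_le[OF yr assms(2)] .
  have "7 / 10 * N * (norm (c *s z - y))\<^sup>2
      \<le> (\<Sum>j\<in>UNIV. weight y j * (cmod ((c *s z) $ j - y $ j))\<^sup>2)"
    unfolding norm_vec_square sum_distrib_left
    by (intro sum_mono) (use weight_ge[OF yr] in \<open>simp add: mult_right_mono del: times_divide_eq_left\<close>)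
  with c(2) have growth: "44 / 100 * N * (norm (c *s z - y))\<^sup>2 \<le> f y - f z"
    by (simp add: fixpoint sum_negf algebra_simps)
  have "d2 z y \<le> norm (c *s z - y)"
  proof -
    have "z - cnj c *s y = cnj c *s (c *s z - y)"
      using cnj_mult_unimodular(1)[OF c(1)]
      by (simp add: vec_eq_iff algebra_simps)
    then have "norm (z - cnj c *s y) = norm (c *s z - y)"
      using c(1) by (simp only: norm_scale_unimodular complex_mod_cnj)
    then show ?thesis
      using d2_le[of "cnj c" z y] c(1) by simp
  qed
  moreover have "0 \<le> d2 z y"
    unfolding d2_def by (rule cINF_greatest) auto
  ultimately have "(d2 z y)\<^sup>2 \<le> (norm (c *s z - y))\<^sup>2"
    by (intro power_mono)
  then have "44 / 100 * N * (d2 z y)\<^sup>2 \<le> 44 / 100 * N * (norm (c *s z - y))\<^sup>2"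
    by (rule mult_left_mono) simp
  also note growth
  finally show ?thesis .
qed

end

theorem theorem3:
  fixes \<alpha> :: real
  shows "\<exists>a lam :: real. 0 < a \<and> 0 < lam \<and> lam < 1 \<and>
    (\<forall>(zstar :: complex^'n) (\<Delta> :: complex^'n^'n) (C :: complex^'n^'n)
       (u :: complex^'n) (a' :: complex^'n) (z0 :: complex^'n) (zhat :: complex^'n).
      zstar \<in> torus \<longrightarrow>
      hermitian \<Delta> \<longrightarrow>
      (\<forall>i. \<Delta> $ i $ i = 0) \<longrightarrow>
      C = outer_product zstar zstar + \<Delta> \<longrightarrow>
      op_norm \<Delta> \<le> real CARD('n) powr (3 / 4) / 312 \<longrightarrow>
      linf_norm (\<Delta> *v zstar) \<le> real CARD('n) / 24 \<longrightarrow>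
      4 \<le> \<alpha> \<longrightarrow>
      (op_norm \<Delta> \<noteq> 0 \<longrightarrow> \<alpha> < real CARD('n) / op_norm \<Delta>) \<longrightarrow>
      leading_eigenvector C u \<longrightarrow>
      herm_inner a' u \<noteq> 0 \<longrightarrow>
      z0 = eigenvector_estimator a' u \<longrightarrow>
      global_maximizer_on (quad_form C) torus zhat \<longrightarrow>
      (\<forall>k. quad_form C zhat - quad_form C (gpm C \<alpha> z0 k)
             \<le> (quad_form C zhat - quad_form C z0) * lam ^ k \<and>
           d2 (gpm C \<alpha> z0 k) zhat
             \<le> a * sqrt (quad_form C zhat - quad_form C z0) * lam powr (real k / 2)))"
\<comment> \<open>\<open>lam = 1 / 2\<close> comes from \<open>step_contracts\<close>;
  \<open>a = 2\<close> works because \<open>1 / 0.44\<close> is below 4.\<close>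
proof (rule exI[of _ 2], rule exI[of _ "1 / 2"], intro conjI allI impI)
  fix zstar :: "complex^'n" and \<Delta> C :: "complex^'n^'n" and u a' z0 zhat :: "complex^'n" and k
  assume zstar: "zstar \<in> torus" and herm: "hermitian \<Delta>" and C: "C = outer_product zstar zstar + \<Delta>"
    and op: "op_norm \<Delta> \<le> real CARD('n) powr (3 / 4) / 312"
    and linf: "linf_norm (\<Delta> *v zstar) \<le> real CARD('n) / 24"
    and \<alpha>: "4 \<le> \<alpha>" "op_norm \<Delta> \<noteq> 0 \<longrightarrow> \<alpha> < real CARD('n) / op_norm \<Delta>"
    and u: "leading_eigenvector C u" "herm_inner a' u \<noteq> 0"
    and z0: "z0 = eigenvector_estimator a' u"
    and zhat: "global_maximizer_on (quad_form C) torus zhat"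
  define \<beta> where "\<beta> = real CARD('n) / \<alpha>"
  interpret phase_synchronization zstar \<Delta> "real CARD('n)"
    by unfold_locales (fact refl zstar herm op linf)+
  interpret power_step zstar \<Delta> "real CARD('n)" \<beta>
  proof unfold_locales
    show "op_norm \<Delta> \<le> \<beta>"
    \<comment> \<open>Without noise the upper limit on \<open>\<alpha>\<close> is infinite, and
      \<open>\<beta> \<ge> 0\<close> is all that has to be shown.\<close>
    proof (cases "op_norm \<Delta> = 0")
      case False
      then have "op_norm \<Delta> > 0" using E_nonneg by simp
      with False \<alpha> show ?thesis by (simp add: \<beta>_def field_simps)
    qed (use \<alpha> in \<open>simp add: \<beta>_def\<close>)
    show "\<beta> \<le> real CARD('n) / 4"
      unfolding \<beta>_def using \<alpha> by (intro divide_left_mono) auto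
  qed
  let ?f = "quad_form C" and ?z = "gpm C \<alpha> z0"
  have zhatr: "zhat \<in> region" using maximizer_in_region zhat by (simp add: C)
  have Suc_step: "?z (Suc i) = step (?z i)" for i
    using \<alpha>(1) unfolding step_def C[symmetric] unfolding \<beta>_def by (intro gpm_Suc_eq) simp
  \<comment> \<open>Membership in the region is carried along, since contraction and growth hold
    only there.\<close>
  have iter: "?z i \<in> region \<and> ?f zhat - ?f (?z i) \<le> (?f zhat - ?f z0) * (1 / 2) ^ i" for i
  proof (induction i)
    case 0
    show ?case
      using eigenvector_estimator_in_region[of u a'] u by (simp add: C z0)
  next
    case (Suc i)
    then have "?f zhat - ?f (step (?z i)) \<le> (?f zhat - ?f (?z i)) / 2"
      using step_contracts[OF _ zhatr] by (simp add: C)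
    with Suc show ?case
      unfolding Suc_step using f_step_ge(2) by simp
  qed
  then show "?f zhat - ?f (?z k) \<le> (?f zhat - ?f z0) * (1 / 2) ^ k" by blast
  have "(d2 (?z k) zhat)\<^sup>2 \<le> real CARD('n) * (d2 (?z k) zhat)\<^sup>2"
    using mult_right_mono[OF N_ge_1, of "(d2 (?z k) zhat)\<^sup>2"] by simp
  also have "\<dots> \<le> 4 * (?f zhat - ?f (?z k))"
  proof -
    have "44 / 100 * (real CARD('n) * (d2 (?z k) zhat)\<^sup>2) \<le> ?f zhat - ?f (?z k)"
      using quadratic_growth[of zhat "?z k"] zhat iter[of k] by (simp add: C mult.assoc)
    moreover have "0 \<le> real CARD('n) * (d2 (?z k) zhat)\<^sup>2" by simp
    moreover have "44 / 100 * x \<le> g \<Longrightarrow> 0 \<le> x \<Longrightarrow> x \<le> 4 * g" for x g :: real by linarith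
    ultimately show ?thesis by blast
  qed
  also have "\<dots> \<le> 4 * ((?f zhat - ?f z0) * (1 / 2) ^ k)"
    using iter[of k] by simp
  finally have "d2 (?z k) zhat \<le> sqrt (4 * ((?f zhat - ?f z0) * (1 / 2) ^ k))"
    by (rule real_le_rsqrt)
  also have "\<dots> = 2 * sqrt (?f zhat - ?f z0) * sqrt ((1 / 2) ^ k)"
    by (simp add: real_sqrt_mult)
  also have "sqrt ((1 / 2) ^ k) = (1 / 2 :: real) powr (real k / 2)"
    by (simp add: powr_half_sqrt[symmetric] powr_realpow[symmetric] powr_powr)
  finally show "d2 (?z k) zhat \<le> 2 * sqrt (?f zhat - ?f z0) * (1 / 2) powr (real k / 2)" .
qed simp_all

end
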